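(* Let $H$ be a complex vector space with scalar product $(\cdot|\cdot)$, let $A$ and $B$ be symmetric operators in $H$ with domains $D(A)$ and $D(B)$, and let $M=D(A)\cap D(B)$, where $M\neq\{0\}$. Let $\varphi\in M$. Then, in each of the following Parts (1)–(5), the listed statements are equivalent to each other (in Parts (1) and (2), for each fixed choice of the sign $\pm$, the same throughout the Part). (1) (i) $(\{A,B\}\varphi|\varphi)=\pm2\|A\varphi\|\|B\varphi\|$. (ii) $\|B\varphi\|A\varphi=\pm\|A\varphi\|B\varphi$. (iii) $(A\varphi|B\varphi)=\pm\|A\varphi\|\|B\varphi\|$. (2) (i) $i([A,B]\varphi|\varphi)=\pm2\|A\varphi\|\|B\varphi\|$. (ii) $\|B\varphi\|A\varphi=\pm i\|A\varphi\|B\varphi$. (iii) $(A\varphi|B\varphi)=\pm i\|A\varphi\|\|B\varphi\|$. (3) (i) $|(\{A,B\}\varphi|\varphi)|=2\|A\varphi\|\|B\varphi\|$. (ii) $([A,B]\varphi|\varphi)=0$ and $|(A\varphi|B\varphi)|=\|A\varphi\|\|B\varphi\|$. (iii) $2\|B\varphi\|^2A\varphi=(\{A,B\}\varphi|\varphi)B\varphi$. (iv) $2\|A\varphi\|^2B\varphi=(\{A,B\}\varphi|\varphi)A\varphi$. (4) (i) $|([A,B]\varphi|\varphi)|=2\|A\varphi\|\|B\varphi\|$. (ii) $(\{A,B\}\varphi|\varphi)=0$ and $|(A\varphi|B\varphi)|=\|A\varphi\|\|B\varphi\|$. (iii) $2\|B\varphi\|^2A\varphi=-([A,B]\varphi|\varphi)B\varphi$.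 (iv) $2\|A\varphi\|^2B\varphi=([A,B]\varphi|\varphi)A\varphi$. (5) (i) $|(A\varphi|B\varphi)|=\|A\varphi\|\|B\varphi\|$. (ii) $\|B\varphi\|A\varphi=[\operatorname{sgn}(A\varphi|B\varphi)]\|A\varphi\|B\varphi$. (iii) $\|B\varphi\|^2A\varphi=(A\varphi|B\varphi)B\varphi$. (iv) $\|A\varphi\|^2B\varphi=\overline{(A\varphi|B\varphi)}A\varphi$.
   Context: The scalar product $(\cdot|\cdot):H\times H\to\mathbb{C}$ is linear in the first variable and antilinear in the second, and $\|u\|=(u|u)^{1/2}$. The commutator $[A,B]$ and anticommutator $\{A,B\}$ are understood as sesquilinear forms on $M=D(A)\cap D(B)$: for $\varphi,\psi\in M$, $$([A,B]\varphi|\psi)=(B\varphi|A\psi)-(A\varphi|B\psi),\qquad (\{A,B\}\varphi|\psi)=(B\varphi|A\psi)+(A\varphi|B\psi).$$ (The left-hand sides are notation for these forms; $AB\varphi$ and $BA\varphi$ need not be defined.) The sign function is $\operatorname{sgn}z=z/|z|$ for $z\in\mathbb{C}\setminus\{0\}$ and $\operatorname{sgn}0=1$. *)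

theory Defs
  imports Complex_Main
begin

text \<open>A complex vector space, carried by a whole type, with a (positive definite) scalar product that
  is linear in the first variable. Antilinearity in the second follows from \<open>ip_cnj\<close>. No completeness
  is assumed.\<close>

locale complex_inner_product_space = vector_space scale
  for scale :: "complex \<Rightarrow> 'h::ab_group_add \<Rightarrow> 'h" (infixr "*\<^sub>C" 75) +
  fixes ip :: "'h \<Rightarrow> 'h \<Rightarrow> complex"
  assumes ip_add_left: "ip (u + v) w = ip u w + ip v w"
    and ip_scale_left: "ip (c *\<^sub>C u) w = c * ip u w"
    and ip_cnj: "ip v u = cnj (ip u v)"
    and ip_nonneg: "0 \<le> Re (ip u u)"
    and ip_definite: "ip u u = 0 \<Longrightarrow> u = 0"

definition ip_norm :: "('h \<Rightarrow> 'h \<Rightarrow> complex) \<Rightarrow> 'h \<Rightarrow> real" where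
  "ip_norm ip u = sqrt (Re (ip u u))"

text \<open>An operator in \<open>H\<close> is given by its domain \<open>D\<close> and a total function \<open>A\<close>, whose values outside
  \<open>D\<close> are irrelevant. Domains are not required to be dense.\<close>

definition linear_operator ::
  "(complex \<Rightarrow> 'h::ab_group_add \<Rightarrow> 'h) \<Rightarrow> 'h set \<Rightarrow> ('h \<Rightarrow> 'h) \<Rightarrow> bool" where
  "linear_operator scale D A \<longleftrightarrow>
     module.subspace scale D \<and>
     (\<forall>u\<in>D. \<forall>v\<in>D. A (u + v) = A u + A v) \<and>
     (\<forall>c. \<forall>u\<in>D. A (scale c u) = scale c (A u))"

definition symmetric_operator ::
  "(complex \<Rightarrow> 'h::ab_group_add \<Rightarrow> 'h) \<Rightarrow> ('h \<Rightarrow> 'h \<Rightarrow> complex) \<Rightarrow> 'h set \<Rightarrow> ('h \<Rightarrow> 'h) \<Rightarrow> bool" where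
  "symmetric_operator scale ip D A \<longleftrightarrow>
     linear_operator scale D A \<and> (\<forall>u\<in>D. \<forall>v\<in>D. ip (A u) v = ip u (A v))"

text \<open>The commutator and anticommutator as sesquilinear forms, meaningful for arguments in
  \<open>D(A) \<inter> D(B)\<close>: \<open>commutator_form ip A B u v\<close> stands for \<open>([A,B]u | v)\<close>, where \<open>AB u\<close> and \<open>BA u\<close>
  need not be defined.\<close>

definition commutator_form ::
  "('h \<Rightarrow> 'h \<Rightarrow> complex) \<Rightarrow> ('h \<Rightarrow> 'h) \<Rightarrow> ('h \<Rightarrow> 'h) \<Rightarrow> 'h \<Rightarrow> 'h \<Rightarrow> complex" where
  "commutator_form ip A B u v = ip (B u) (A v) - ip (A u) (B v)"

definition anticommutator_form ::
  "('h \<Rightarrow> 'h \<Rightarrow> complex) \<Rightarrow> ('h \<Rightarrow> 'h) \<Rightarrow> ('h \<Rightarrow> 'h) \<Rightarrow> 'h \<Rightarrow> 'h \<Rightarrow> complex" where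
  "anticommutator_form ip A B u v = ip (B u) (A v) + ip (A u) (B v)"

text \<open>Differs from the library's \<open>sgn\<close> in its value at \<open>0\<close>.\<close>

definition csgn1 :: "complex \<Rightarrow> complex" where
  "csgn1 z = (if z = 0 then 1 else z / of_real (cmod z))"

definition all_equivalent :: "bool list \<Rightarrow> bool" where
  "all_equivalent Ps \<longleftrightarrow> (\<forall>P\<in>set Ps. \<forall>Q\<in>set Ps. P \<longleftrightarrow> Q)"

end

theory Submission imports Defs begin

text \<open>Write \<open>x = A \<phi>\<close>, \<open>y = B \<phi>\<close> and \<open>z = (x | y)\<close>. Then the anticommutator form at \<open>\<phi>\<close> is \<open>2 Re z\<close>
  and the commutator form is \<open>-2\<i> Im z\<close>. For every complex \<open>w\<close>, the squared norm of \<open>\<parallel>y\<parallel>\<^sup>2 x - w y\<close> is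
  \<open>\<parallel>y\<parallel>\<^sup>2 (|w - z|\<^sup>2 + \<parallel>x\<parallel>\<^sup>2 \<parallel>y\<parallel>\<^sup>2 - |z|\<^sup>2)\<close>. The choice \<open>w = z\<close> gives the Cauchy-Schwarz inequality;
  in general, \<open>\<parallel>y\<parallel>\<^sup>2 x = w y\<close> with \<open>y \<noteq> 0\<close> means \<open>w = z\<close> and equality in Cauchy-Schwarz. So each vector
  equation becomes a condition on \<open>z\<close>, and only elementary facts on complex numbers remain.\<close>

text \<open>Each list is settled by comparing its members with one pivot \<open>Q\<close>, which
  need not be in the list: Parts 3 and 4 use a condition on \<open>z\<close> alone.\<close>

lemma all_equivalentI:
  assumes "\<And>P. P \<in> set Ps \<Longrightarrow> P \<longleftrightarrow> Q"
  shows "all_equivalent Ps"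
  using assms unfolding all_equivalent_def by blast

text \<open>The value 1 at 0 makes this hold without exception, so \<open>csgn1 z\<close> is
  admissible as the unimodular factor in \<open>norm_scale_eq_iff\<close>.\<close>

lemma cmod_csgn1 [simp]: "cmod (csgn1 z) = 1"
  by (simp add: csgn1_def norm_divide)

lemma csgn1_mult_cmod [simp]: "csgn1 z * of_real (cmod z) = z"
  by (simp add: csgn1_def)

text \<open>Since \<open>\<bar>Re z\<bar> \<le> cmod z \<le> r\<close>, equality of the outer terms
  forces both equalities, and the first leaves no imaginary part. Later \<open>r\<close> is the
  Cauchy-Schwarz bound.\<close>

lemma abs_Re_eq_iff:
  assumes "cmod z \<le> r"
  shows "\<bar>Re z\<bar> = r \<longleftrightarrow> Im z = 0 \<and> cmod z = r"
proof
  assume r: "\<bar>Re z\<bar> = r"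
  then have "cmod z = r"
    using assms abs_Re_le_cmod [of z] by linarith
  moreover from this have "(cmod z)\<^sup>2 = (Re z)\<^sup>2"
    using r by (metis power2_abs)
  ultimately show "Im z = 0 \<and> cmod z = r"
    using cmod_power2 [of z] by simp
qed (auto simp: cmod_eq_Re)

text \<open>Multiplication by \<open>\<i>\<close> keeps the modulus and exchanges real and imaginary
  part up to sign.\<close>

lemma abs_Im_eq_iff:
  assumes "cmod z \<le> r"
  shows "\<bar>Im z\<bar> = r \<longleftrightarrow> Re z = 0 \<and> cmod z = r"
  using abs_Re_eq_iff [of "\<i> * z" r] assms by (simp add: norm_mult)

context complex_inner_product_space
begin

lemma ip_add_right: "ip u (v + w) = ip u v + ip u w"
  by (metis ip_add_left ip_cnj complex_cnj_add)

lemma ip_scale_right: "ip u (c *\<^sub>C v) = cnj c * ip u v"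
  by (metis ip_scale_left ip_cnj complex_cnj_mult)

lemma ip_diff_left: "ip (u - v) w = ip u w - ip v w"
  using ip_add_left [of "u - v" v w] by simp

lemma ip_diff_right: "ip u (v - w) = ip u v - ip u w"
  using ip_add_right [of u "v - w" w] by simp

lemma ip_zero_left [simp]: "ip 0 u = 0"
  using ip_diff_left [of 0 0 u] by simp

lemma ip_zero_right [simp]: "ip u 0 = 0"
  using ip_diff_right [of u 0 0] by simp

lemma ip_norm_nonneg: "0 \<le> ip_norm ip u"
  by (simp add: ip_norm_def ip_nonneg)

lemma ip_self: "ip u u = of_real ((ip_norm ip u)\<^sup>2)"
proof -
  have "Im (ip u u) = 0"
    using arg_cong [OF ip_cnj [of u u], of Im] by simp
  then show ?thesis
    by (simp add: ip_norm_def ip_nonneg complex_eq_iff)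
qed

lemma ip_norm_eq_0_iff [simp]: "ip_norm ip u = 0 \<longleftrightarrow> u = 0"
  using ip_definite [of u] by (auto simp: ip_self) (simp add: ip_norm_def)

text \<open>Expanding the scalar product and completing the square in \<open>w\<close> gives the
  right-hand side. The weight \<open>(ip_norm ip y)\<^sup>2\<close> on \<open>x\<close> avoids
  division, so \<open>y = 0\<close> is included.\<close>

lemma ip_norm_scale_diff:
  "(ip_norm ip (of_real ((ip_norm ip y)\<^sup>2) *\<^sub>C x - w *\<^sub>C y))\<^sup>2 =
   (ip_norm ip y)\<^sup>2 * ((cmod (w - ip x y))\<^sup>2 + ((ip_norm ip x * ip_norm ip y)\<^sup>2 - (cmod (ip x y))\<^sup>2))"
  (is "?l = ?r")
proof -
  have yx: "ip y x = cnj (ip x y)"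
    by (rule ip_cnj)
  \<comment> \<open>The identity is checked in the complex numbers, where squared norms are values
    of \<open>ip\<close> and \<open>(cmod z)\<^sup>2\<close> is \<open>z * cnj z\<close>.\<close>
  have "complex_of_real ?l = complex_of_real ?r"
    unfolding ip_self [symmetric]
    by (simp add: ip_diff_left ip_diff_right ip_scale_left ip_scale_right yx ip_self [of x] ip_self [of y]
        complex_norm_square [unfolded of_real_power] power_mult_distrib algebra_simps)
  then show ?thesis
    by (simp only: of_real_eq_iff)
qed

lemma cauchy_schwarz: "cmod (ip x y) \<le> ip_norm ip x * ip_norm ip y"
proof (cases "y = 0")
  case False
  then have "0 < (ip_norm ip y)\<^sup>2"
    by simp
  moreover have "0 \<le> (ip_norm ip y)\<^sup>2 * ((ip_norm ip x * ip_norm ip y)\<^sup>2 - (cmod (ip x y))\<^sup>2)"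
    using ip_norm_scale_diff [of y x "ip x y"] by (metis norm_zero diff_self power_zero_numeral add_0 zero_le_power2)
  ultimately have "(cmod (ip x y))\<^sup>2 \<le> (ip_norm ip x * ip_norm ip y)\<^sup>2"
    by (simp add: zero_le_mult_iff)
  then show ?thesis
    by (rule power2_le_imp_le) (simp add: ip_norm_nonneg)
qed (simp add: ip_norm_nonneg)

text \<open>The assumption handles \<open>y = 0\<close>: there the vector equation always holds,
  while the right-hand side reduces to \<open>w = 0\<close>.\<close>

lemma scale_eq_scale_iff:
  assumes "y = 0 \<Longrightarrow> w = 0"
  shows "of_real ((ip_norm ip y)\<^sup>2) *\<^sub>C x = w *\<^sub>C y \<longleftrightarrow>
    w = ip x y \<and> cmod (ip x y) = ip_norm ip x * ip_norm ip y"
proof (cases "y = 0")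
  case True
  then show ?thesis
    using assms by simp
next
  case False
  have le: "(cmod (ip x y))\<^sup>2 \<le> (ip_norm ip x * ip_norm ip y)\<^sup>2"
    by (intro power_mono cauchy_schwarz) simp
  have "of_real ((ip_norm ip y)\<^sup>2) *\<^sub>C x = w *\<^sub>C y \<longleftrightarrow>
      (ip_norm ip (of_real ((ip_norm ip y)\<^sup>2) *\<^sub>C x - w *\<^sub>C y))\<^sup>2 = 0"
    by simp
  also have "\<dots> \<longleftrightarrow>
      (cmod (w - ip x y))\<^sup>2 + ((ip_norm ip x * ip_norm ip y)\<^sup>2 - (cmod (ip x y))\<^sup>2) = 0"
    unfolding ip_norm_scale_diff using False by simp
  also have "\<dots> \<longleftrightarrow> w = ip x y \<and> (cmod (ip x y))\<^sup>2 = (ip_norm ip x * ip_norm ip y)\<^sup>2"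
    \<comment> \<open>Both summands are nonnegative, the second by Cauchy-Schwarz, so both
      vanish.\<close>
    using le by (subst add_nonneg_eq_0_iff) auto
  also have "\<dots> \<longleftrightarrow> w = ip x y \<and> cmod (ip x y) = ip_norm ip x * ip_norm ip y"
    by (simp add: power2_eq_iff_nonneg ip_norm_nonneg)
  finally show ?thesis .
qed

lemma scale_eq_scale_iff':
  assumes "x = 0 \<Longrightarrow> w = 0"
  shows "of_real ((ip_norm ip x)\<^sup>2) *\<^sub>C y = w *\<^sub>C x \<longleftrightarrow>
    w = cnj (ip x y) \<and> cmod (ip x y) = ip_norm ip x * ip_norm ip y"
  using scale_eq_scale_iff [of x w y] assms by (simp add: ip_cnj [of y x] mult.commute)

text \<open>Multiplying by the norm of \<open>y\<close> reduces this to
  \<open>scale_eq_scale_iff\<close>. As \<open>c\<close> is unimodular, the value found for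
  \<open>ip x y\<close> already has the modulus required there. The signs of Parts 1, 2 and 5 are
  all such \<open>c\<close>.\<close>

lemma norm_scale_eq_iff:
  assumes "cmod c = 1"
  shows "of_real (ip_norm ip y) *\<^sub>C x = (c * of_real (ip_norm ip x)) *\<^sub>C y \<longleftrightarrow>
    ip x y = c * of_real (ip_norm ip x) * of_real (ip_norm ip y)"
proof (cases "y = 0")
  case True
  then show ?thesis
    by (simp add: ip_norm_eq_0_iff [THEN iffD2])
next
  case False
  let ?b = "complex_of_real (ip_norm ip y)"
  have "?b *\<^sub>C x = (c * of_real (ip_norm ip x)) *\<^sub>C y \<longleftrightarrow>
      ?b *\<^sub>C (?b *\<^sub>C x) = ?b *\<^sub>C ((c * of_real (ip_norm ip x)) *\<^sub>C y)"
    using False by (subst scale_cancel_left) simp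
  also have "\<dots> \<longleftrightarrow> of_real ((ip_norm ip y)\<^sup>2) *\<^sub>C x = (c * of_real (ip_norm ip x) * ?b) *\<^sub>C y"
    by (simp add: power2_eq_square mult.commute)
  also have "\<dots> \<longleftrightarrow> c * of_real (ip_norm ip x) * ?b = ip x y \<and>
      cmod (ip x y) = ip_norm ip x * ip_norm ip y"
    using False by (intro scale_eq_scale_iff) simp
  also have "\<dots> \<longleftrightarrow> ip x y = c * of_real (ip_norm ip x) * ?b"
    using assms by (auto simp: norm_mult ip_norm_nonneg dest: arg_cong [of _ _ cmod])
  finally show ?thesis .
qed

text \<open>On the diagonal the two terms of the form are complex conjugates of each other.\<close>

lemma anticommutator_form_eq: "anticommutator_form ip A B u u = of_real (2 * Re (ip (A u) (B u)))"
  by (simp add: anticommutator_form_def ip_cnj [of "B u" "A u"] complex_eq_iff)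

lemma commutator_form_eq: "commutator_form ip A B u u = - \<i> * of_real (2 * Im (ip (A u) (B u)))"
  by (simp add: commutator_form_def ip_cnj [of "B u" "A u"] complex_eq_iff)

end

theorem theorem2p2:
  fixes scale :: "complex \<Rightarrow> 'h::ab_group_add \<Rightarrow> 'h" (infixr "*\<^sub>C" 75)
    and ip :: "'h \<Rightarrow> 'h \<Rightarrow> complex"
    and D\<^sub>A D\<^sub>B :: "'h set" and A B :: "'h \<Rightarrow> 'h" and \<phi> :: 'h
  assumes "complex_inner_product_space scale ip"
    and "symmetric_operator scale ip D\<^sub>A A"
    and "symmetric_operator scale ip D\<^sub>B B"
    and "D\<^sub>A \<inter> D\<^sub>B \<noteq> {0}"
    and "\<phi> \<in> D\<^sub>A \<inter> D\<^sub>B"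
  shows "
    (\<forall>s\<in>{1, -1 :: complex}. all_equivalent
      [anticommutator_form ip A B \<phi> \<phi> = s * 2 * of_real (ip_norm ip (A \<phi>)) * of_real (ip_norm ip (B \<phi>)),
       of_real (ip_norm ip (B \<phi>)) *\<^sub>C A \<phi> = (s * of_real (ip_norm ip (A \<phi>))) *\<^sub>C B \<phi>,
       ip (A \<phi>) (B \<phi>) = s * of_real (ip_norm ip (A \<phi>)) * of_real (ip_norm ip (B \<phi>))]) \<and>
    (\<forall>s\<in>{1, -1 :: complex}. all_equivalent
      [\<i> * commutator_form ip A B \<phi> \<phi> = s * 2 * of_real (ip_norm ip (A \<phi>)) * of_real (ip_norm ip (B \<phi>)),
       of_real (ip_norm ip (B \<phi>)) *\<^sub>C A \<phi> = (s * \<i> * of_real (ip_norm ip (A \<phi>))) *\<^sub>C B \<phi>,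
       ip (A \<phi>) (B \<phi>) = s * \<i> * of_real (ip_norm ip (A \<phi>)) * of_real (ip_norm ip (B \<phi>))]) \<and>
    all_equivalent
      [cmod (anticommutator_form ip A B \<phi> \<phi>) = 2 * ip_norm ip (A \<phi>) * ip_norm ip (B \<phi>),
       commutator_form ip A B \<phi> \<phi> = 0 \<and> cmod (ip (A \<phi>) (B \<phi>)) = ip_norm ip (A \<phi>) * ip_norm ip (B \<phi>),
       of_real (2 * (ip_norm ip (B \<phi>))\<^sup>2) *\<^sub>C A \<phi> = anticommutator_form ip A B \<phi> \<phi> *\<^sub>C B \<phi>,
       of_real (2 * (ip_norm ip (A \<phi>))\<^sup>2) *\<^sub>C B \<phi> = anticommutator_form ip A B \<phi> \<phi> *\<^sub>C A \<phi>] \<and>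
    all_equivalent
      [cmod (commutator_form ip A B \<phi> \<phi>) = 2 * ip_norm ip (A \<phi>) * ip_norm ip (B \<phi>),
       anticommutator_form ip A B \<phi> \<phi> = 0 \<and> cmod (ip (A \<phi>) (B \<phi>)) = ip_norm ip (A \<phi>) * ip_norm ip (B \<phi>),
       of_real (2 * (ip_norm ip (B \<phi>))\<^sup>2) *\<^sub>C A \<phi> = (- commutator_form ip A B \<phi> \<phi>) *\<^sub>C B \<phi>,
       of_real (2 * (ip_norm ip (A \<phi>))\<^sup>2) *\<^sub>C B \<phi> = commutator_form ip A B \<phi> \<phi> *\<^sub>C A \<phi>] \<and>
    all_equivalent
      [cmod (ip (A \<phi>) (B \<phi>)) = ip_norm ip (A \<phi>) * ip_norm ip (B \<phi>),
       of_real (ip_norm ip (B \<phi>)) *\<^sub>C A \<phi> = (csgn1 (ip (A \<phi>) (B \<phi>)) * of_real (ip_norm ip (A \<phi>))) *\<^sub>C B \<phi>,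
       of_real ((ip_norm ip (B \<phi>))\<^sup>2) *\<^sub>C A \<phi> = ip (A \<phi>) (B \<phi>) *\<^sub>C B \<phi>,
       of_real ((ip_norm ip (A \<phi>))\<^sup>2) *\<^sub>C B \<phi> = cnj (ip (A \<phi>) (B \<phi>)) *\<^sub>C A \<phi>]"
proof -
  interpret complex_inner_product_space scale ip
    by fact
  define x y z where "x = A \<phi>" and "y = B \<phi>" and "z = ip x y"
  define a b where "a = ip_norm ip x" and "b = ip_norm ip y"
  have ac: "anticommutator_form ip A B \<phi> \<phi> = of_real (2 * Re z)"
    and co: "commutator_form ip A B \<phi> \<phi> = - \<i> * of_real (2 * Im z)"
    by (simp_all only: anticommutator_form_eq commutator_form_eq x_def y_def z_def)
  have le: "cmod z \<le> a * b"
    unfolding z_def a_def b_def by (rule cauchy_schwarz)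
  then have ab: "0 \<le> a * b"
    using norm_ge_zero order_trans by blast
  \<comment> \<open>This supplies the side conditions of \<open>sq\<close> and \<open>sq'\<close>
    for multipliers built from \<open>z\<close>.\<close>
  have z0: "z = 0" if "x = 0 \<or> y = 0"
    using that by (auto simp: z_def)
  have lin: "of_real b *\<^sub>C x = (c * of_real a) *\<^sub>C y \<longleftrightarrow> z = c * of_real a * of_real b"
    if "cmod c = 1" for c
    unfolding a_def b_def z_def using that by (rule norm_scale_eq_iff)
  have sq: "of_real (b\<^sup>2) *\<^sub>C x = w *\<^sub>C y \<longleftrightarrow> w = z \<and> cmod z = a * b"
    if "y = 0 \<Longrightarrow> w = 0" for w
    unfolding a_def b_def z_def using that by (rule scale_eq_scale_iff)
  have sq': "of_real (a\<^sup>2) *\<^sub>C y = w *\<^sub>C x \<longleftrightarrow> w = cnj z \<and> cmod z = a * b"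
    if "x = 0 \<Longrightarrow> w = 0" for w
    unfolding a_def b_def z_def using that by (rule scale_eq_scale_iff')
  have double: "of_real (2 * r) *\<^sub>C u = (2 * w) *\<^sub>C v \<longleftrightarrow> of_real r *\<^sub>C u = w *\<^sub>C v" for r w u v
    using scale_cancel_left [of 2 "of_real r *\<^sub>C u" "w *\<^sub>C v"] by simp
  have part1: "all_equivalent
      [anticommutator_form ip A B \<phi> \<phi> = s * 2 * of_real a * of_real b,
       of_real b *\<^sub>C x = (s * of_real a) *\<^sub>C y,
       z = s * of_real a * of_real b]" if "s \<in> {1, -1}" for s :: complex
  proof (rule all_equivalentI)
    have "anticommutator_form ip A B \<phi> \<phi> = s * 2 * of_real a * of_real b \<longleftrightarrow> z = s * of_real a * of_real b"
      \<comment> \<open>The form only gives \<open>Re z = s * a * b\<close>. This real part has the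
        largest modulus that \<open>le\<close> permits, so the imaginary part is 0.\<close>
      unfolding ac using that abs_Re_eq_iff [OF le] ab by (auto simp: complex_eq_iff)
    then show "P \<longleftrightarrow> z = s * of_real a * of_real b"
      if "P \<in> set [anticommutator_form ip A B \<phi> \<phi> = s * 2 * of_real a * of_real b,
        of_real b *\<^sub>C x = (s * of_real a) *\<^sub>C y, z = s * of_real a * of_real b]" for P
      using that \<open>s \<in> {1, -1}\<close> lin [of s] by auto
  qed
  have part2: "all_equivalent
      [\<i> * commutator_form ip A B \<phi> \<phi> = s * 2 * of_real a * of_real b,
       of_real b *\<^sub>C x = (s * \<i> * of_real a) *\<^sub>C y,
       z = s * \<i> * of_real a * of_real b]" if "s \<in> {1, -1}" for s :: complex
  proof (rule all_equivalentI)
    have "\<i> * commutator_form ip A B \<phi> \<phi> = s * 2 * of_real a * of_real b \<longleftrightarrow> z = s * \<i> * of_real a * of_real b"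
      \<comment> \<open>The factor \<open>\<i>\<close> turns the form into \<open>2 * Im z\<close>;
        now the extremal imaginary part forces the real part to be 0.\<close>
      unfolding co using that abs_Im_eq_iff [OF le] ab by (auto simp: complex_eq_iff)
    then show "P \<longleftrightarrow> z = s * \<i> * of_real a * of_real b"
      if "P \<in> set [\<i> * commutator_form ip A B \<phi> \<phi> = s * 2 * of_real a * of_real b,
        of_real b *\<^sub>C x = (s * \<i> * of_real a) *\<^sub>C y, z = s * \<i> * of_real a * of_real b]" for P
      using that \<open>s \<in> {1, -1}\<close> lin [of "s * \<i>"] by (auto simp: norm_mult)
  qed
  have part3: "all_equivalent
      [cmod (anticommutator_form ip A B \<phi> \<phi>) = 2 * a * b,
       commutator_form ip A B \<phi> \<phi> = 0 \<and> cmod z = a * b,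
       of_real (2 * b\<^sup>2) *\<^sub>C x = anticommutator_form ip A B \<phi> \<phi> *\<^sub>C y,
       of_real (2 * a\<^sup>2) *\<^sub>C y = anticommutator_form ip A B \<phi> \<phi> *\<^sub>C x]"
  proof (rule all_equivalentI)
    \<comment> \<open>With the factor 2 isolated, \<open>double\<close> cancels it and leaves the
      multiplier \<open>Re z\<close>, which equals \<open>z\<close>, or equally
      \<open>cnj z\<close>, exactly when \<open>Im z = 0\<close>.\<close>
    have ac': "anticommutator_form ip A B \<phi> \<phi> = 2 * of_real (Re z)"
      by (simp add: ac)
    have "cmod (anticommutator_form ip A B \<phi> \<phi>) = 2 * a * b \<longleftrightarrow> \<bar>Re z\<bar> = a * b"
      by (simp add: ac' norm_mult)
    moreover have "of_real (2 * b\<^sup>2) *\<^sub>C x = anticommutator_form ip A B \<phi> \<phi> *\<^sub>C y \<longleftrightarrow>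
        Im z = 0 \<and> cmod z = a * b"
      unfolding ac' double using z0 by (subst sq) (auto simp: complex_eq_iff)
    moreover have "of_real (2 * a\<^sup>2) *\<^sub>C y = anticommutator_form ip A B \<phi> \<phi> *\<^sub>C x \<longleftrightarrow>
        Im z = 0 \<and> cmod z = a * b"
      unfolding ac' double using z0 by (subst sq') (auto simp: complex_eq_iff)
    ultimately show "P \<longleftrightarrow> Im z = 0 \<and> cmod z = a * b"
      if "P \<in> set [cmod (anticommutator_form ip A B \<phi> \<phi>) = 2 * a * b,
        commutator_form ip A B \<phi> \<phi> = 0 \<and> cmod z = a * b,
        of_real (2 * b\<^sup>2) *\<^sub>C x = anticommutator_form ip A B \<phi> \<phi> *\<^sub>C y,
        of_real (2 * a\<^sup>2) *\<^sub>C y = anticommutator_form ip A B \<phi> \<phi> *\<^sub>C x]" for P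
      using that abs_Re_eq_iff [OF le] by (auto simp: co)
  qed
  have part4: "all_equivalent
      [cmod (commutator_form ip A B \<phi> \<phi>) = 2 * a * b,
       anticommutator_form ip A B \<phi> \<phi> = 0 \<and> cmod z = a * b,
       of_real (2 * b\<^sup>2) *\<^sub>C x = (- commutator_form ip A B \<phi> \<phi>) *\<^sub>C y,
       of_real (2 * a\<^sup>2) *\<^sub>C y = commutator_form ip A B \<phi> \<phi> *\<^sub>C x]"
  proof (rule all_equivalentI)
    \<comment> \<open>The opposite signs in the two vector equations match conjugation:
      \<open>\<i> * Im z\<close> equals \<open>z\<close>, and \<open>- \<i> * Im z\<close> equals
      \<open>cnj z\<close>, exactly when \<open>Re z = 0\<close>.\<close>
    have co': "commutator_form ip A B \<phi> \<phi> = 2 * (- \<i> * of_real (Im z))"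
      and mco': "- commutator_form ip A B \<phi> \<phi> = 2 * (\<i> * of_real (Im z))"
      by (simp_all add: co)
    have "cmod (commutator_form ip A B \<phi> \<phi>) = 2 * a * b \<longleftrightarrow> \<bar>Im z\<bar> = a * b"
      by (simp add: co' norm_mult)
    moreover have "of_real (2 * b\<^sup>2) *\<^sub>C x = (- commutator_form ip A B \<phi> \<phi>) *\<^sub>C y \<longleftrightarrow>
        Re z = 0 \<and> cmod z = a * b"
      unfolding mco' double using z0 by (subst sq) (auto simp: complex_eq_iff)
    moreover have "of_real (2 * a\<^sup>2) *\<^sub>C y = commutator_form ip A B \<phi> \<phi> *\<^sub>C x \<longleftrightarrow>
        Re z = 0 \<and> cmod z = a * b"
      unfolding co' double using z0 by (subst sq') (auto simp: complex_eq_iff)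
    ultimately show "P \<longleftrightarrow> Re z = 0 \<and> cmod z = a * b"
      if "P \<in> set [cmod (commutator_form ip A B \<phi> \<phi>) = 2 * a * b,
        anticommutator_form ip A B \<phi> \<phi> = 0 \<and> cmod z = a * b,
        of_real (2 * b\<^sup>2) *\<^sub>C x = (- commutator_form ip A B \<phi> \<phi>) *\<^sub>C y,
        of_real (2 * a\<^sup>2) *\<^sub>C y = commutator_form ip A B \<phi> \<phi> *\<^sub>C x]" for P
      using that abs_Im_eq_iff [OF le] by (auto simp: ac)
  qed
  have part5: "all_equivalent
      [cmod z = a * b,
       of_real b *\<^sub>C x = (csgn1 z * of_real a) *\<^sub>C y,
       of_real (b\<^sup>2) *\<^sub>C x = z *\<^sub>C y,
       of_real (a\<^sup>2) *\<^sub>C y = cnj z *\<^sub>C x]"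
  proof (rule all_equivalentI)
    \<comment> \<open>The convention at 0 matters here: for \<open>z = 0\<close> the equation reads
      \<open>0 = a * b\<close>, whereas a sign of 0 would make it hold for all \<open>a\<close> and
      \<open>b\<close>.\<close>
    have "z = csgn1 z * of_real a * of_real b \<longleftrightarrow> cmod z = a * b"
    proof
      assume "z = csgn1 z * of_real a * of_real b"
      then have "cmod z = cmod (csgn1 z * of_real a * of_real b)"
        by simp
      then show "cmod z = a * b"
        by (simp add: norm_mult a_def b_def ip_norm_nonneg)
    next
      assume "cmod z = a * b"
      then show "z = csgn1 z * of_real a * of_real b"
        using csgn1_mult_cmod [of z] by (simp add: mult.assoc)
    qed
    then show "P \<longleftrightarrow> cmod z = a * b"
      if "P \<in> set [cmod z = a * b, of_real b *\<^sub>C x = (csgn1 z * of_real a) *\<^sub>C y,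
        of_real (b\<^sup>2) *\<^sub>C x = z *\<^sub>C y, of_real (a\<^sup>2) *\<^sub>C y = cnj z *\<^sub>C x]" for P
      using that lin [of "csgn1 z"] sq [of z] sq' [of "cnj z"] z0 by auto
  qed
  show ?thesis
    using part1 part2 part3 part4 part5 unfolding x_def y_def z_def a_def b_def by blast
qed

end
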